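(* Let $n$ agents, of whom $k\ge1$ are honest and $n-k$ are malicious, share an $n$-qubit pure state $|\Psi\rangle$ with $F'(|\Psi\rangle)\ge\sqrt{1-\epsilon^2}$, where $0\le\epsilon\le1$. Suppose the Sender is each of the $k$ honest agents with equal probability. Then the probability that the malicious agents can guess the identity of the Sender satisfies $$\Pr[\text{guess}]\;\le\;\frac1k+\epsilon .$$
   Context: For pure states $F(|\psi\rangle,|\phi\rangle)=|\langle\psi|\phi\rangle|^2$. For $y\in\{0,1\}^n$ let $\Delta(y)=\sum_iy_i$ be the Hamming weight. The ideal state is $$|\Phi_0^n\rangle=\frac1{\sqrt{2^{n-1}}}\Big[\sum_{\Delta(y)\equiv0\,(4)}|y\rangle-\sum_{\Delta(y)\equiv2\,(4)}|y\rangle\Big],$$ which is obtained from the GHZ state $\frac1{\sqrt2}(|0^n\rangle+|1^n\rangle)$ by applying a Hadamard and then $\sqrt Z=\mathrm{diag}(1,i)$ to each qubit. Each agent holds one qubit. $F'(|\Psi\rangle)=\max_UF(U|\Psi\rangle,|\Phi_0^n\rangle)$, where $U$ ranges over unitary operations on the space of the malicious agents (the $n-k$ qubits they hold). In this frame the Sender's transformation is $\sigma_x\sigma_z$ (first $\sigma_z$, then $\sigma_x$; so $|0\rangle\mapsto|1\rangle$, $|1\rangle\mapsto-|0\rangle$) applied to the Sender's qubit. For an honest agent $i$, $|\Psi_i\rangle$ denotes the $n$-qubit state after agent $i$, as the Sender, has applied this transformation to the shared state (after the malicious agents have applied the unitary $U$ attaining the maximum in $F'$; since $U$ acts on different qubits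 it commutes with the Sender's transformation). The malicious agents are allowed to have in their possession the entire quantum state. Guessing the Sender means performing a measurement to discriminate the $k$ equiprobable states $|\Psi_i\rangle$, $i$ honest: $$\Pr[\text{guess}]=\max_{\{\Pi_i\}}\sum_{i}\frac1k\operatorname{Tr}\big(\Pi_i|\Psi_i\rangle\langle\Psi_i|\big),$$ the maximum being over POVMs $\{\Pi_i\}$ indexed by the $k$ honest agents. *)

theory Defs
  imports "HOL-Analysis.Analysis"
begin

text \<open>
  Agents are the elements of a finite type \<^typ>\<open>'a\<close>, each holding one qubit. A bit string in
  \<open>{0,1}^n\<close> with \<open>n = CARD('a)\<close> is a function \<^typ>\<open>'a \<Rightarrow> bool\<close> (\<open>True\<close> is the bit \<open>1\<close>), and the
  \<open>n\<close>-qubit space has these functions as its computational basis.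
\<close>

type_synonym 'a qstate = "complex ^ ('a \<Rightarrow> bool)"
type_synonym 'a qop = "complex ^ ('a \<Rightarrow> bool) ^ ('a \<Rightarrow> bool)"

definition braket :: "complex ^ 'x \<Rightarrow> complex ^ 'x::finite \<Rightarrow> complex" where
  "braket \<psi> \<phi> = (\<Sum>x\<in>UNIV. cnj (\<psi> $ x) * \<phi> $ x)"

definition ketbra :: "complex ^ 'x \<Rightarrow> complex ^ 'x::finite \<Rightarrow> complex ^ 'x ^ 'x" where
  "ketbra \<psi> \<phi> = (\<chi> x y. \<psi> $ x * cnj (\<phi> $ y))"

definition dagger :: "complex ^ 'x ^ 'x \<Rightarrow> complex ^ 'x ^ 'x::finite" where
  "dagger A = (\<chi> x y. cnj (A $ y $ x))"

definition pos_semidef :: "complex ^ 'x ^ 'x::finite \<Rightarrow> bool" where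
  "pos_semidef A \<longleftrightarrow> dagger A = A \<and> (\<forall>v. 0 \<le> Re (braket v (A *v v)))"

definition fidelity :: "complex ^ 'x \<Rightarrow> complex ^ 'x::finite \<Rightarrow> real" where
  "fidelity \<psi> \<phi> = (cmod (braket \<psi> \<phi>))\<^sup>2"

definition hamming_weight :: "('a::finite \<Rightarrow> bool) \<Rightarrow> nat" where
  "hamming_weight y = card {i. y i}"

definition ideal_state :: "'a::finite qstate" where
  "ideal_state = (\<chi> y.
     (if hamming_weight y mod 4 = 0 then 1
      else if hamming_weight y mod 4 = 2 then -1
      else 0) / complex_of_real (sqrt (2 ^ (CARD('a) - 1))))"

text \<open>
  The computational basis of the qubits in \<open>S\<close> is \<open>S \<rightarrow>\<^sub>E UNIV\<close>. An operator on these qubits is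
  given by its matrix entries \<open>V x y\<close> (row \<open>x\<close>, column \<open>y\<close>); entries with \<open>x\<close> or \<open>y\<close> outside
  \<open>S \<rightarrow>\<^sub>E UNIV\<close> are irrelevant.
\<close>

definition unitary_on :: "'a::finite set \<Rightarrow> (('a \<Rightarrow> bool) \<Rightarrow> ('a \<Rightarrow> bool) \<Rightarrow> complex) \<Rightarrow> bool" where
  "unitary_on S V \<longleftrightarrow>
     (\<forall>x\<in>S \<rightarrow>\<^sub>E UNIV. \<forall>y\<in>S \<rightarrow>\<^sub>E UNIV.
        (\<Sum>z\<in>S \<rightarrow>\<^sub>E UNIV. cnj (V z x) * V z y) = (if x = y then 1 else 0) \<and>
        (\<Sum>z\<in>S \<rightarrow>\<^sub>E UNIV. V x z * cnj (V y z)) = (if x = y then 1 else 0))"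

text \<open>The operator \<open>V \<otimes> I\<close>, with \<open>V\<close> on the qubits in \<open>S\<close> and the identity on the others.\<close>

definition on_qubits :: "'a::finite set \<Rightarrow> (('a \<Rightarrow> bool) \<Rightarrow> ('a \<Rightarrow> bool) \<Rightarrow> complex) \<Rightarrow> 'a qop" where
  "on_qubits S V = (\<chi> x y. if \<forall>j. j \<notin> S \<longrightarrow> x j = y j then V (restrict x S) (restrict y S) else 0)"

definition local_unitaries :: "'a::finite set \<Rightarrow> 'a qop set" where
  "local_unitaries S = {on_qubits S V | V. unitary_on S V}"

definition pauli_x :: "complex ^ bool ^ bool" where
  "pauli_x = (\<chi> a b. if a \<noteq> b then 1 else 0)"

definition pauli_z :: "complex ^ bool ^ bool" where
  "pauli_z = (\<chi> a b. if a = b then (if a then -1 else 1) else 0)"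

definition sender_op :: "'a::finite \<Rightarrow> 'a qop" where
  "sender_op i = on_qubits {i} (\<lambda>x y. (pauli_x ** pauli_z) $ x i $ y i)"

text \<open>
  For the set \<open>M\<close> of malicious agents: \<open>F'\<close> of the shared state, and the unitaries attaining it.
  That the supremum is a maximum is \<open>best_unitary_exists\<close> below.
\<close>

definition max_fidelity :: "'a::finite set \<Rightarrow> 'a qstate \<Rightarrow> real" where
  "max_fidelity M \<psi> = (SUP U\<in>local_unitaries M. fidelity (U *v \<psi>) ideal_state)"

definition best_unitary :: "'a::finite set \<Rightarrow> 'a qstate \<Rightarrow> 'a qop \<Rightarrow> bool" where
  "best_unitary M \<psi> U \<longleftrightarrow>
     is_arg_max (\<lambda>U. fidelity (U *v \<psi>) ideal_state) (\<lambda>U. U \<in> local_unitaries M) U"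

definition povm :: "'a set \<Rightarrow> ('a \<Rightarrow> complex ^ 'x ^ 'x::finite) \<Rightarrow> bool" where
  "povm H P \<longleftrightarrow> (\<forall>i\<in>H. pos_semidef (P i)) \<and> (\<Sum>i\<in>H. P i) = mat 1"

text \<open>
  The summands of \<open>guess_value\<close> are real for a POVM, so taking the real part only changes the
  type. That the supremum in \<open>guess_prob\<close> is a maximum is \<open>best_povm_exists\<close> below.
\<close>

definition guess_value ::
    "'a set \<Rightarrow> ('a \<Rightarrow> complex ^ 'x) \<Rightarrow> ('a \<Rightarrow> complex ^ 'x ^ 'x::finite) \<Rightarrow> real" where
  "guess_value H \<psi> P = (\<Sum>i\<in>H. 1 / real (card H) * Re (trace (P i ** ketbra (\<psi> i) (\<psi> i))))"

definition guess_prob :: "'a set \<Rightarrow> ('a \<Rightarrow> complex ^ 'x::finite) \<Rightarrow> real" where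
  "guess_prob H \<psi> = (SUP P\<in>{P. povm H P}. guess_value H \<psi> P)"


subsection \<open>The suprema are attained\<close>

lemma norm_vec_le:
  fixes v :: "'b::real_normed_vector ^ 'x::finite"
  assumes "\<And>x. norm (v $ x) \<le> B"
  shows "norm v \<le> real CARD('x) * B"
proof -
  have "norm v \<le> (\<Sum>x\<in>UNIV. norm (v $ x))"
    unfolding norm_vec_def by (rule L2_set_le_sum) simp
  also have "\<dots> \<le> (\<Sum>x\<in>(UNIV::'x set). B)"
    by (rule sum_mono) (use assms in simp)
  finally show ?thesis by simp
qed

lemma compact_local_unitaries: "compact (local_unitaries (S :: 'a::finite set))"
proof -
  define C :: "('a \<Rightarrow> bool) set" where "C = S \<rightarrow>\<^sub>E UNIV"
  define K :: "'a qop set" where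
    "K = {W. (\<forall>x y. x \<notin> C \<or> y \<notin> C \<longrightarrow> W $ x $ y = 0) \<and> unitary_on S (\<lambda>x y. W $ x $ y)}"
  have "closed K"
  proof -
    have K_eq: "K = (\<Inter>x. \<Inter>y. {W. x \<notin> C \<or> y \<notin> C \<longrightarrow> W $ x $ y = 0}) \<inter>
        (\<Inter>x\<in>C. \<Inter>y\<in>C. {W. (\<Sum>z\<in>C. cnj (W $ z $ x) * W $ z $ y) = (if x = y then 1 else 0)} \<inter>
                      {W. (\<Sum>z\<in>C. W $ x $ z * cnj (W $ y $ z)) = (if x = y then 1 else 0)})"
      unfolding K_def unitary_on_def C_def[symmetric] by blast
    have cl: "closed {W :: 'a qop. b \<longrightarrow> W $ x $ y = 0}" for b x y
      by (cases b) (auto intro!: closed_Collect_eq continuous_intros)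
    show ?thesis
      unfolding K_eq
      by (intro closed_Int closed_INT ballI cl closed_Collect_eq continuous_intros)
  qed
  moreover have "bounded K"
  proof -
    have "norm (W $ x $ y) \<le> 1" if W: "W \<in> K" for W x y
    proof (cases "x \<in> C \<and> y \<in> C")
      case True
      have "(\<Sum>z\<in>C. cnj (W $ z $ y) * W $ z $ y) = 1"
        using W True unfolding K_def unitary_on_def C_def[symmetric] by simp
      moreover have "(\<Sum>z\<in>C. cnj (W $ z $ y) * W $ z $ y) =
          complex_of_real (\<Sum>z\<in>C. (cmod (W $ z $ y))\<^sup>2)"
        by (simp only: of_real_sum complex_norm_square mult.commute)
      ultimately have eq: "(\<Sum>z\<in>C. (cmod (W $ z $ y))\<^sup>2) = 1"
        using of_real_eq_1_iff by metis
      have "(cmod (W $ x $ y))\<^sup>2 \<le> (\<Sum>z\<in>C. (cmod (W $ z $ y))\<^sup>2)"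
        by (rule member_le_sum) (use True in auto)
      then show ?thesis
        using eq by (simp add: power_le_one_iff abs_square_le_1)
    next
      case False
      then show ?thesis using W by (auto simp: K_def)
    qed
    then have "norm W \<le> real CARD('a \<Rightarrow> bool) * (real CARD('a \<Rightarrow> bool) * 1)" if "W \<in> K" for W
      using that by (intro norm_vec_le) simp
    then show ?thesis unfolding bounded_iff by blast
  qed
  ultimately have "compact K" by (simp add: compact_eq_bounded_closed)
  moreover have "continuous_on K (\<lambda>W. on_qubits S (\<lambda>x y. W $ x $ y))"
  proof -
    have "continuous_on K (\<lambda>W. if b then W $ x $ y else 0)" for b x y
      by (cases b) (auto intro!: continuous_intros)
    then show ?thesis
      unfolding on_qubits_def by (intro continuous_on_vec_lambda) 
  qed
  ultimately have "compact ((\<lambda>W. on_qubits S (\<lambda>x y. W $ x $ y)) ` K)"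
    by (rule compact_continuous_image[rotated])
  moreover have "local_unitaries S = (\<lambda>W. on_qubits S (\<lambda>x y. W $ x $ y)) ` K"
  proof (intro equalityI subsetI)
    fix U assume "U \<in> local_unitaries S"
    then obtain V where V: "U = on_qubits S V" "unitary_on S V"
      by (auto simp: local_unitaries_def)
    define W :: "'a qop" where "W = (\<chi> x y. if x \<in> C \<and> y \<in> C then V x y else 0)"
    have "W \<in> K"
      using V(2) unfolding K_def unitary_on_def C_def[symmetric] by (simp add: W_def)
    moreover have "U = on_qubits S (\<lambda>x y. W $ x $ y)"
    proof -
      have "restrict x S \<in> C" for x by (simp add: C_def)
      then show ?thesis by (auto simp: V(1) on_qubits_def W_def vec_eq_iff)
    qed
    ultimately show "U \<in> (\<lambda>W. on_qubits S (\<lambda>x y. W $ x $ y)) ` K" by blast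
  next
    fix U assume "U \<in> (\<lambda>W. on_qubits S (\<lambda>x y. W $ x $ y)) ` K"
    then show "U \<in> local_unitaries S"
      by (auto simp: local_unitaries_def K_def)
  qed
  ultimately show ?thesis by simp
qed

lemma local_unitaries_nonempty: "local_unitaries S \<noteq> {}"
proof -
  have 1: "cnj (if b then 1 else 0) = (if b then 1 else 0)" for b by simp
  have 2: "(if b then 1 else 0) * w = (if b then w else 0)" for b and w :: complex by simp
  have 3: "finite (S \<rightarrow>\<^sub>E (UNIV :: bool set))" by simp
  have "unitary_on S (\<lambda>x y. if x = y then 1 else 0)"
    unfolding unitary_on_def 1 2
  proof (intro ballI conjI)
    fix x y assume "x \<in> S \<rightarrow>\<^sub>E (UNIV :: bool set)" "y \<in> S \<rightarrow>\<^sub>E (UNIV :: bool set)"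
    then show "(\<Sum>z\<in>S \<rightarrow>\<^sub>E UNIV. if z = x then if z = y then 1 else 0 else 0) = (if x = y then 1 else 0)"
      by (subst sum.delta[OF 3]) auto
  next
    fix x y assume "x \<in> S \<rightarrow>\<^sub>E (UNIV :: bool set)" "y \<in> S \<rightarrow>\<^sub>E (UNIV :: bool set)"
    then show "(\<Sum>z\<in>S \<rightarrow>\<^sub>E UNIV. if x = z then if y = z then 1 else 0 else 0) = (if x = y then 1 else 0)"
      by (subst sum.delta'[OF 3]) auto
  qed
  then show ?thesis by (auto simp: local_unitaries_def)
qed

lemma best_unitary_exists: "\<exists>U. best_unitary M \<psi> U"
proof -
  have "continuous_on (local_unitaries M) (\<lambda>U. fidelity (U *v \<psi>) ideal_state)"
    unfolding fidelity_def braket_def matrix_vector_mult_def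
    by (auto intro!: continuous_intros)
  from continuous_attains_sup[OF compact_local_unitaries local_unitaries_nonempty this]
  show ?thesis unfolding best_unitary_def is_arg_max_linorder by blast
qed

lemma best_unitary_attains:
  assumes "best_unitary M \<psi> U"
  shows "max_fidelity M \<psi> = fidelity (U *v \<psi>) ideal_state"
  using assms unfolding max_fidelity_def best_unitary_def is_arg_max_linorder
  by (intro cSup_eq_maximum) auto

lemma pos_semidef_entry_bound:
  fixes A :: "complex ^ 'x ^ 'x::finite"
  assumes "pos_semidef A"
  shows "0 \<le> Re (A $ x $ x)" "2 * cmod (A $ x $ y) \<le> Re (A $ x $ x) + Re (A $ y $ y)"
proof -
  have nonneg: "0 \<le> Re (braket v (A *v v))" for v
    using assms by (simp add: pos_semidef_def)
  have herm: "A $ b $ a = cnj (A $ a $ b)" for a b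
    using assms unfolding pos_semidef_def dagger_def by (metis vec_lambda_beta)
  have entry: "(\<Sum>a\<in>UNIV. (axis p c $ a) * f a) = c * f p" for p and c :: complex and f :: "'x \<Rightarrow> complex"
    by (simp add: axis_def if_distrib if_distribR cong: if_cong)
  have entry_cnj: "(\<Sum>a\<in>UNIV. cnj (axis p c $ a) * f a) = cnj c * f p" for p and c :: complex and f :: "'x \<Rightarrow> complex"
    by (simp add: axis_def if_distrib if_distribR cong: if_cong)
  have mv: "(A *v axis p c) $ a = c * A $ a $ p" for p c a
    using entry[of p c "\<lambda>b. A $ a $ b"] by (simp add: matrix_vector_mult_def mult.commute)
  show "0 \<le> Re (A $ x $ x)"
    using nonneg[of "axis x 1"] unfolding braket_def entry_cnj mv by simp
  show "2 * cmod (A $ x $ y) \<le> Re (A $ x $ x) + Re (A $ y $ y)"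
  proof (cases "A $ x $ y = 0")
    case True
    then show ?thesis
      using nonneg[of "axis x 1"] nonneg[of "axis y 1"] unfolding braket_def entry_cnj mv by simp
  next
    case False
    define r where "r = cmod (A $ x $ y)"
    define c where "c = - cnj (A $ x $ y) / r"
    have r: "r > 0" using False by (simp add: r_def)
    have zz: "A $ x $ y * cnj (A $ x $ y) = r * r"
      unfolding r_def by (metis complex_norm_square of_real_mult power2_eq_square)
    have c1: "c * A $ x $ y = - of_real r" "cnj c * c = 1" "cnj c * A $ y $ x = - of_real r"
      using r zz by (simp_all add: c_def herm[where a=x and b=y] field_simps)
    let ?v = "axis x 1 + axis y c"
    have "braket ?v (A *v ?v) =
        (A $ x $ x + c * A $ x $ y) + (cnj c * A $ y $ x + cnj c * c * A $ y $ y)"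
      unfolding braket_def vector_add_component matrix_vector_right_distrib complex_cnj_add
        distrib_right sum.distrib entry_cnj mv
      by (simp add: algebra_simps)
    then have "braket ?v (A *v ?v) = A $ x $ x + A $ y $ y - 2 * of_real r"
      unfolding c1 by simp
    then have "0 \<le> Re (A $ x $ x + A $ y $ y - 2 * of_real r)"
      using nonneg[of ?v] by simp
    then show ?thesis by (simp add: r_def)
  qed
qed

lemma best_povm_exists:
  fixes \<psi> :: "'a::finite \<Rightarrow> complex ^ 'x::finite"
  assumes "H \<noteq> {}"
  shows "\<exists>P. is_arg_max (guess_value H \<psi>) (povm H) P"
proof -
  define K :: "(complex ^ 'x ^ 'x ^ 'a) set" where
    "K = {P. (\<forall>i. i \<notin> H \<longrightarrow> P $ i = 0) \<and> povm H (\<lambda>i. P $ i)}"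
  have "closed K"
  proof -
    have K_eq: "K = (\<Inter>i\<in>-H. {P. P $ i = 0}) \<inter>
        (\<Inter>i\<in>H. {P. dagger (P $ i) = P $ i} \<inter> (\<Inter>v. {P. 0 \<le> Re (braket v (P $ i *v v))})) \<inter>
        {P. (\<Sum>i\<in>H. P $ i) = mat 1}"
      unfolding K_def povm_def pos_semidef_def by auto
    show ?thesis
      unfolding K_eq dagger_def braket_def matrix_vector_mult_def
      by (auto intro!: closed_Int closed_INT closed_Collect_eq closed_Collect_le continuous_intros)
  qed
  moreover have "bounded K"
  proof -
    have "norm (P $ i $ x $ y) \<le> 1" if P: "P \<in> K" for P i x y
    proof (cases "i \<in> H")
      case True
      have psd: "pos_semidef (P $ j)" if "j \<in> H" for j
        using P that by (auto simp: K_def povm_def)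
      have "Re (P $ i $ a $ a) \<le> 1" for a
      proof -
        have "(\<Sum>j\<in>H. P $ j) $ a $ a = 1"
          using P by (auto simp: K_def povm_def mat_def)
        then have "(\<Sum>j\<in>H. Re (P $ j $ a $ a)) = 1"
          by (metis (no_types, lifting) Re_sum one_complex.sel(1) sum.cong sum_component)
        moreover have "Re (P $ i $ a $ a) \<le> (\<Sum>j\<in>H. Re (P $ j $ a $ a))"
          by (rule member_le_sum) (use True psd pos_semidef_entry_bound(1) in auto)
        ultimately show ?thesis by simp
      qed
      from this[of x] this[of y] pos_semidef_entry_bound(2)[OF psd[OF True], of x y]
      show ?thesis by simp
    next
      case False
      then show ?thesis using P by (auto simp: K_def)
    qed
    then have "norm P \<le> real CARD('a) * (real CARD('x) * (real CARD('x) * 1))" if "P \<in> K" for P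
      using that by (intro norm_vec_le) simp
    then show ?thesis unfolding bounded_iff by blast
  qed
  ultimately have "compact K" by (simp add: compact_eq_bounded_closed)
  moreover have "K \<noteq> {}"
  proof -
    obtain h where h: "h \<in> H" using assms by blast
    have "Re (braket v v) \<ge> 0" for v :: "complex ^ 'x"
      unfolding braket_def by (auto intro!: sum_nonneg)
    then have id: "pos_semidef (mat 1 :: complex ^ 'x ^ 'x)"
      by (auto simp: pos_semidef_def dagger_def vec_eq_iff) (simp_all add: mat_def)
    have zero: "pos_semidef (0 :: complex ^ 'x ^ 'x)"
      by (simp add: pos_semidef_def dagger_def braket_def vec_eq_iff matrix_vector_mult_def)
    have "(\<chi> i. if i = h then mat 1 else 0) \<in> K"
      using h id zero by (auto simp: K_def povm_def)
    then show ?thesis by blast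
  qed
  moreover have "continuous_on K (\<lambda>P. guess_value H \<psi> (\<lambda>i. P $ i))"
    unfolding guess_value_def trace_def matrix_matrix_mult_def
    by (auto intro!: continuous_intros)
  ultimately have "\<exists>P\<in>K. \<forall>Q\<in>K. guess_value H \<psi> (\<lambda>i. Q $ i) \<le> guess_value H \<psi> (\<lambda>i. P $ i)"
    by (rule continuous_attains_sup)
  then obtain P where P: "P \<in> K"
    "\<And>Q. Q \<in> K \<Longrightarrow> guess_value H \<psi> (\<lambda>i. Q $ i) \<le> guess_value H \<psi> (\<lambda>i. P $ i)"
    by blast
  have "guess_value H \<psi> Q \<le> guess_value H \<psi> (\<lambda>i. P $ i)" if Q: "povm H Q" for Q
  proof -
    have "(\<chi> i. if i \<in> H then Q i else 0) \<in> K"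
      using Q by (auto simp: K_def povm_def)
    from P(2)[OF this] show ?thesis by (simp add: guess_value_def)
  qed
  then have "is_arg_max (guess_value H \<psi>) (povm H) (\<lambda>i. P $ i)"
    using P(1) by (auto simp: is_arg_max_linorder K_def)
  then show ?thesis by blast
qed

end

theory Submission
  imports Defs
begin

text \<open>
  The Sender's transformation takes the ideal state to the same state \<open>\<Phi>\<^sub>1\<close> whichever agent is the
  Sender, and guessing among \<open>k\<close> copies of one state succeeds with probability exactly \<open>1/k\<close>.
  Being unitary, the transformation preserves the fidelity with the ideal state, so each actual
  state has trace distance at most \<open>sqrt (1 - F') \<le> \<epsilon>\<close> from \<open>\<Phi>\<^sub>1\<close>, and no measurement outcome can
  be more likely on it than on \<open>\<Phi>\<^sub>1\<close> by more than \<open>\<epsilon>\<close>.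
\<close>

section \<open>Inner products and traces as quadratic forms\<close>

text \<open>Lets outcome probabilities be estimated with the real inner product;
  \<open>braket\<close> remains necessary only where phases matter.\<close>

lemma Re_braket: "Re (braket a b) = a \<bullet> b"
  by (simp add: braket_def inner_vec_def inner_complex_def)

lemma braket_self: "braket a a = complex_of_real ((norm a)\<^sup>2)"
proof -
  have "braket a a = complex_of_real (Re (braket a a))"
    by (simp add: braket_def complex_eq_iff)
  then show ?thesis by (simp add: Re_braket power2_norm_eq_inner)
qed

lemma braket_smult_right: "braket a (c *s b) = c * braket a b"
  by (simp add: braket_def sum_distrib_left mult_ac)

lemma braket_smult_left: "braket (c *s a) b = cnj c * braket a b"
  by (simp add: braket_def sum_distrib_left mult_ac)

lemma matrix_vector_mult_braket:
  "braket a (A *v b) = (\<Sum>x\<in>UNIV. \<Sum>y\<in>UNIV. cnj (a $ x) * A $ x $ y * b $ y)"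
  by (simp add: braket_def matrix_vector_mult_def sum_distrib_left mult_ac)

lemma trace_mult_ketbra: "trace (A ** ketbra \<psi> \<psi>) = braket \<psi> (A *v \<psi>)"
  by (simp add: matrix_vector_mult_braket trace_def matrix_matrix_mult_def ketbra_def mult_ac)

lemma braket_dagger: "braket (A *v a) b = braket a (dagger A *v b)"
proof -
  have "braket (A *v a) b = (\<Sum>x\<in>UNIV. \<Sum>y\<in>UNIV. cnj (a $ y) * cnj (A $ x $ y) * b $ x)"
    by (simp add: braket_def matrix_vector_mult_def sum_distrib_left sum_distrib_right mult_ac)
  also have "\<dots> = (\<Sum>y\<in>UNIV. \<Sum>x\<in>UNIV. cnj (a $ y) * cnj (A $ x $ y) * b $ x)"
    by (rule sum.swap)
  finally show ?thesis by (simp add: matrix_vector_mult_braket dagger_def)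
qed

section \<open>Distinguishing two pure states by one outcome\<close>

lemma matrix_vector_scaleR:
  fixes A :: "complex ^ 'x::finite ^ 'x"
  shows "A *v (c *\<^sub>R v) = c *\<^sub>R (A *v v)"
  by (simp add: vec_eq_iff matrix_vector_mult_def scaleR_sum_right)

text \<open>
  Polarization: with \<open>u = a - b\<close> and \<open>v = a + b\<close>, comparing the form at \<open>\<parallel>v\<parallel>u \<plusminus> \<parallel>u\<parallel>v\<close> bounds the
  difference by \<open>\<parallel>u\<parallel>\<parallel>v\<parallel>/2\<close>.
\<close>

lemma quadratic_form_diff_le:
  fixes A :: "complex ^ 'x::finite ^ 'x"
  assumes nonneg: "\<And>v. 0 \<le> v \<bullet> (A *v v)" and le: "\<And>v. v \<bullet> (A *v v) \<le> v \<bullet> v"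
    and a: "norm a = 1" and b: "norm b = 1"
  shows "a \<bullet> (A *v a) - b \<bullet> (A *v b) \<le> norm (a - b) * norm (a + b) / 2"
proof -
  define q where "q v = v \<bullet> (A *v v)" for v
  define r where "r = norm (a - b)"
  define s where "s = norm (a + b)"
  have rr: "r * r = (a - b) \<bullet> (a - b)" and ss: "s * s = (a + b) \<bullet> (a + b)"
    by (simp_all add: r_def s_def flip: power2_norm_eq_inner power2_eq_square)
  have ab: "a \<bullet> a = 1" "b \<bullet> b = 1"
    using a b by (simp_all flip: power2_norm_eq_inner)
  show ?thesis
  proof (cases "r = 0 \<or> s = 0")
    case True
    then have "a = b \<or> a = -1 *\<^sub>R b"
      by (auto simp: r_def s_def add_eq_0_iff)
    then have "q a = q b"
      unfolding q_def by (auto simp only: matrix_vector_scaleR) simp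
    then show ?thesis unfolding q_def[symmetric] by simp
  next
    case False
    then have pos: "r * s > 0" by (simp add: r_def s_def)
    let ?x = "s *\<^sub>R (a - b) + r *\<^sub>R (a + b)"
    let ?y = "s *\<^sub>R (a - b) - r *\<^sub>R (a + b)"
    \<comment> \<open>With u = a - b and v = a + b only the mixed terms survive, and u . A v + v . A
      u = 2 (q a - q b).\<close>
    have "4 * (r * s) * (q a - q b) = q ?x - q ?y"
      unfolding q_def matrix_vector_right_distrib matrix_vector_mult_diff_distrib matrix_vector_scaleR
      by (simp add: inner_simps algebra_simps)
    also have "\<dots> \<le> ?x \<bullet> ?x"
      using nonneg[of ?y] le[of ?x] unfolding q_def by simp
    also have "\<dots> = s * s * ((a - b) \<bullet> (a - b)) + r * r * ((a + b) \<bullet> (a + b))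
        + 2 * (r * s) * (a \<bullet> a - b \<bullet> b)"
      by (simp add: inner_simps algebra_simps inner_commute)
    \<comment> \<open>The weights s and r turn each of the first two summands into r*r*s*s; the
      mixed one vanishes because a and b are unit vectors.\<close>
    also have "\<dots> = 4 * (r * s) * (r * s / 2)"
      unfolding rr[symmetric] ss[symmetric] ab by simp
    finally have "q a - q b \<le> r * s / 2"
      using pos by (simp only: mult_le_cancel_left_pos mult_pos_pos zero_less_numeral)
    then show ?thesis
      unfolding q_def r_def s_def .
  qed
qed

text \<open>Multiplying b by a phase changes neither its norm nor its form. Choosing the phase that
  makes the overlap with a equal to its modulus turns the previous bound into the trace
  distance.\<close>

lemma quadratic_form_diff_le_fidelity:
  fixes A :: "complex ^ 'x::finite ^ 'x"
  assumes nonneg: "\<And>v. 0 \<le> v \<bullet> (A *v v)" and le: "\<And>v. v \<bullet> (A *v v) \<le> v \<bullet> v"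
    and a: "norm a = 1" and b: "norm b = 1"
  shows "a \<bullet> (A *v a) - b \<bullet> (A *v b) \<le> sqrt (1 - fidelity a b)"
proof -
  define z where "z = braket a b"
  \<comment> \<open>The case split keeps \<omega> of modulus 1, since
    \<open>sgn 0 = 0\<close>.\<close>
  define \<omega> where "\<omega> = (if z = 0 then 1 else cnj (sgn z))"
  define b' where "b' = \<omega> *s b"
  have \<omega>: "cnj \<omega> * \<omega> = 1"
    by (simp add: \<omega>_def norm_sgn flip: complex_norm_square mult.commute[of _ "cnj _"])
  have \<omega>z: "\<omega> * z = of_real (cmod z)"
    using complex_norm_square[of z]
    by (auto simp: \<omega>_def sgn_eq field_simps power2_eq_square)
  have "braket b' b' = braket b b"
    unfolding b'_def braket_smult_left braket_smult_right using \<omega> by (simp add: mult.commute)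
  then have b': "norm b' = 1"
    using b unfolding braket_self of_real_eq_iff by (simp add: abs_square_eq_1)
  have "A *v b' = \<omega> *s (A *v b)"
    unfolding b'_def by (simp add: vec_eq_iff matrix_vector_mult_def sum_distrib_left mult_ac)
  then have "braket b' (A *v b') = braket b (A *v b)"
    unfolding b'_def braket_smult_left braket_smult_right mult.assoc[symmetric]
    by (simp add: braket_smult_left braket_smult_right \<omega> flip: mult.assoc)
  then have form: "b' \<bullet> (A *v b') = b \<bullet> (A *v b)"
    by (simp flip: Re_braket)
  have inner: "a \<bullet> b' = cmod z"
    by (simp add: b'_def braket_smult_right \<omega>z flip: Re_braket z_def)
  have "(norm (a - b'))\<^sup>2 * (norm (a + b'))\<^sup>2 = (2 - 2 * cmod z) * (2 + 2 * cmod z)"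
    using a b' inner unfolding power2_norm_eq_inner norm_eq_1
    by (simp add: inner_simps inner_commute)
  also have "\<dots> = 4 * (1 - fidelity a b)"
    by (simp add: fidelity_def z_def algebra_simps power2_eq_square)
  finally have sq: "(norm (a - b') * norm (a + b'))\<^sup>2 = 4 * (1 - fidelity a b)"
    by (simp add: power_mult_distrib)
  have "norm (a - b') * norm (a + b') = sqrt (4 * (1 - fidelity a b))"
    unfolding sq[symmetric] by simp
  also have "\<dots> = 2 * sqrt (1 - fidelity a b)"
    unfolding real_sqrt_mult by simp
  finally show ?thesis
    using quadratic_form_diff_le[OF nonneg le a b'] form by simp
qed

section \<open>Unitaries of the malicious agents\<close>

text \<open>Columns x and y that differ outside S have disjoint supports. If they agree there, the
  rows that contribute agree with them outside S, and restricting these to S gives the column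
  orthonormality of V.\<close>

lemma dagger_on_qubits_mult:
  assumes V: "unitary_on S V"
  shows "dagger (on_qubits S V) ** on_qubits S V = mat 1"
proof -
  let ?C = "S \<rightarrow>\<^sub>E (UNIV :: bool set)"
  have "(\<Sum>z\<in>UNIV. cnj (on_qubits S V $ z $ x) * on_qubits S V $ z $ y) = (if x = y then 1 else 0)"
    for x y
  proof (cases "\<forall>j. j \<notin> S \<longrightarrow> x j = y j")
    case True
    let ?Z = "{z. \<forall>j. j \<notin> S \<longrightarrow> z j = x j}"
    have "(\<Sum>z\<in>UNIV. cnj (on_qubits S V $ z $ x) * on_qubits S V $ z $ y)
        = (\<Sum>z\<in>?Z. cnj (V (restrict z S) (restrict x S)) * V (restrict z S) (restrict y S))"
      using True by (intro sum.mono_neutral_cong_right) (auto simp: on_qubits_def)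
    also have "\<dots> = (\<Sum>w\<in>?C. cnj (V w (restrict x S)) * V w (restrict y S))"
      by (rule sum.reindex_bij_witness[where i="\<lambda>w j. if j \<in> S then w j else x j"
            and j="\<lambda>z. restrict z S"])
        (auto simp: fun_eq_iff PiE_def extensional_def)
    also have "\<dots> = (if restrict x S = restrict y S then 1 else 0)"
      using V unfolding unitary_on_def by auto
    also have "restrict x S = restrict y S \<longleftrightarrow> x = y"
      using True by (auto simp: fun_eq_iff restrict_def split: if_splits)
    finally show ?thesis .
  next
    case False
    then have "(\<Sum>z\<in>UNIV. cnj (on_qubits S V $ z $ x) * on_qubits S V $ z $ y) = 0"
      by (intro sum.neutral) (auto simp: on_qubits_def)
    then show ?thesis using False by auto
  qed
  then show ?thesis
    by (simp add: vec_eq_iff matrix_matrix_mult_def dagger_def mat_def)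
qed

lemma norm_local_unitary:
  assumes "U \<in> local_unitaries S"
  shows "norm (U *v \<psi>) = norm \<psi>"
proof -
  have "dagger U ** U = mat 1"
    using assms dagger_on_qubits_mult by (auto simp: local_unitaries_def)
  then have "braket (U *v \<psi>) (U *v \<psi>) = braket \<psi> \<psi>"
    by (simp add: braket_dagger matrix_vector_mul_assoc)
  then show ?thesis unfolding braket_self of_real_eq_iff by simp
qed

section \<open>The Sender's transformation and the ideal state\<close>

lemma sender_op_nth:
  "(sender_op i *v \<psi>) $ x = (if x i then 1 else -1) * \<psi> $ (x(i := \<not> x i))"
proof -
  have eq: "(\<forall>j. j \<noteq> i \<longrightarrow> x j = y j) \<longleftrightarrow> y = x \<or> y = x(i := \<not> x i)" for y
    by (auto simp: fun_eq_iff)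
  have ne: "x(i := \<not> x i) \<noteq> x" by (metis fun_upd_same)
  have xz: "(pauli_x ** pauli_z) $ p $ q = (if p = q then 0 else if p then 1 else -1)" for p q
    by (cases p; cases q) (simp_all add: pauli_x_def pauli_z_def matrix_matrix_mult_def UNIV_bool)
  have "(sender_op i *v \<psi>) $ x = (\<Sum>y\<in>UNIV. sender_op i $ x $ y * \<psi> $ y)"
    by (simp add: matrix_vector_mult_def)
  also have "\<dots> = (\<Sum>y\<in>{x(i := \<not> x i)}. sender_op i $ x $ y * \<psi> $ y)"
    by (intro sum.mono_neutral_right) (auto simp: sender_op_def on_qubits_def eq xz)
  also have "\<dots> = (if x i then 1 else -1) * \<psi> $ (x(i := \<not> x i))"
    by (simp add: sender_op_def on_qubits_def xz)
  finally show ?thesis .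
qed

lemma braket_sender_op: "braket (sender_op i *v a) (sender_op i *v b) = braket a b"
proof -
  have "braket (sender_op i *v a) (sender_op i *v b)
      = (\<Sum>x\<in>UNIV. cnj (a $ (x(i := \<not> x i))) * b $ (x(i := \<not> x i)))"
    unfolding braket_def sender_op_nth by (intro sum.cong) auto
  also have "\<dots> = braket a b"
    unfolding braket_def
    by (rule sum.reindex_bij_witness[where i="\<lambda>x. x(i := \<not> x i)" and j="\<lambda>x. x(i := \<not> x i)"]) auto
  finally show ?thesis .
qed

lemma norm_sender_op: "norm (sender_op i *v a) = norm a"
  using braket_sender_op[of i a a] unfolding braket_self of_real_eq_iff by simp

lemma hamming_weight_flip:
  "hamming_weight x = (if x i then Suc (hamming_weight (x(i := \<not> x i)))
     else hamming_weight (x(i := \<not> x i)) - 1)"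
  "\<not> x i \<Longrightarrow> 0 < hamming_weight (x(i := \<not> x i))"
proof -
  have "{j. x j} = insert i {j. (x(i := \<not> x i)) j}" if "x i" using that by auto
  moreover have "{j. (x(i := \<not> x i)) j} = insert i {j. x j}" if "\<not> x i" using that by auto
  ultimately show "hamming_weight x = (if x i then Suc (hamming_weight (x(i := \<not> x i)))
     else hamming_weight (x(i := \<not> x i)) - 1)" "\<not> x i \<Longrightarrow> 0 < hamming_weight (x(i := \<not> x i))"
    by (auto simp: hamming_weight_def)
qed

text \<open>The right-hand side does not mention i: this is what hides the Sender. An amplitude at
  weight w comes from weight w - 1 with its sign kept (bit 1) or from w + 1 with its sign reversed
  (bit 0), and these agree because amplitudes of the ideal state at weights differing by 2 are
  opposite.\<close>

lemma sender_op_ideal_state_nth: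
  "(sender_op i *v (ideal_state :: 'a::finite qstate)) $ x =
     (if hamming_weight x mod 4 = 1 then 1 else if hamming_weight x mod 4 = 3 then -1 else 0)
       / complex_of_real (sqrt (2 ^ (CARD('a) - 1)))"
proof (cases "x i")
  case True
  then have w: "hamming_weight x = Suc (hamming_weight (x(i := \<not> x i)))"
    using hamming_weight_flip(1)[of x i] by simp
  show ?thesis
    unfolding sender_op_nth ideal_state_def w using True by (simp add: mod_Suc)
next
  case False
  then have w: "hamming_weight (x(i := \<not> x i)) = Suc (hamming_weight x)"
    using hamming_weight_flip[of x i] by simp
  show ?thesis
    unfolding sender_op_nth ideal_state_def vec_lambda_beta w using False by (simp add: mod_Suc)
qed

text \<open>Avoids counting strings of even weight: the state and its image under
  \<open>sender_op i\<close> have complementary supports (even and odd weights), so their squared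
  norms sum to 2, and the two norms are equal.\<close>

lemma norm_ideal_state: "norm (ideal_state :: 'a::finite qstate) = 1"
proof -
  fix i :: 'a
  define N :: real where "N = 2 ^ (CARD('a) - 1)"
  have N: "N > 0" by (simp add: N_def)
  let ?\<Phi> = "ideal_state :: 'a qstate"
  have norm2: "(norm v)\<^sup>2 = (\<Sum>x\<in>UNIV. (cmod (v $ x))\<^sup>2)" for v :: "'a qstate"
    by (simp add: norm_vec_def L2_set_def sum_nonneg)
  have "(cmod (?\<Phi> $ x))\<^sup>2 + (cmod ((sender_op i *v ?\<Phi>) $ x))\<^sup>2 = 1 / N" for x
  proof -
    have "hamming_weight x mod 4 \<in> {0, 1, 2, 3}" by auto
    then show ?thesis
      unfolding sender_op_ideal_state_nth N_def[symmetric]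
      using N by (auto simp: ideal_state_def norm_divide power_divide N_def)
  qed
  then have "(norm ?\<Phi>)\<^sup>2 + (norm (sender_op i *v ?\<Phi>))\<^sup>2 = real CARD('a \<Rightarrow> bool) * (1 / N)"
    unfolding norm2 by (simp flip: sum.distrib)
  \<comment> \<open>There is at least one agent, so the exponent \<open>CARD('a) - 1\<close> is not
    truncated.\<close>
  also have "real CARD('a \<Rightarrow> bool) = 2 * N"
    unfolding N_def using zero_less_card_finite[where 'a='a]
    by (simp add: card_fun flip: power_Suc)
  finally show ?thesis using N by (simp add: norm_sender_op abs_square_eq_1)
qed

section \<open>Measurements and the guessing probability\<close>

lemma povm_inner_sum:
  assumes "povm H P"
  shows "(\<Sum>i\<in>H. v \<bullet> (P i *v v)) = v \<bullet> v"
proof -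
  have "(\<Sum>i\<in>H. P i *v v) = (\<Sum>i\<in>H. P i) *v v"
    by (induction H rule: infinite_finite_induct)
      (simp_all add: matrix_vector_mult_add_rdistrib)
  then show ?thesis
    using assms by (simp add: povm_def flip: inner_sum_right)
qed

lemma povm_inner_bounds:
  assumes P: "povm H P" and "finite H" "i \<in> H"
  shows "0 \<le> v \<bullet> (P i *v v)" "v \<bullet> (P i *v v) \<le> v \<bullet> v"
proof -
  have nonneg: "0 \<le> v \<bullet> (P j *v v)" if "j \<in> H" for j
    using P that by (simp add: povm_def pos_semidef_def Re_braket)
  then show "0 \<le> v \<bullet> (P i *v v)" using assms by blast
  show "v \<bullet> (P i *v v) \<le> v \<bullet> v"
    unfolding povm_inner_sum[OF P, symmetric]
    by (rule member_le_sum) (use assms nonneg in auto)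
qed

text \<open>Replacing every state by \<phi> costs at most \<epsilon> per outcome, and the outcome
  probabilities on \<phi> sum to 1.\<close>

lemma guess_value_le:
  fixes \<psi> :: "'a::finite \<Rightarrow> complex ^ 'x::finite"
  assumes P: "povm H P" and "H \<noteq> {}"
    and norm: "\<And>i. i \<in> H \<Longrightarrow> norm (\<psi> i) = 1" "norm \<phi> = 1"
    and close: "\<And>i. i \<in> H \<Longrightarrow> sqrt (1 - fidelity (\<psi> i) \<phi>) \<le> \<epsilon>"
  shows "guess_value H \<psi> P \<le> 1 / real (card H) + \<epsilon>"
proof -
  have card: "real (card H) > 0" using \<open>H \<noteq> {}\<close> by (simp add: card_gt_0_iff)
  have "\<psi> i \<bullet> (P i *v \<psi> i) \<le> \<phi> \<bullet> (P i *v \<phi>) + \<epsilon>" if "i \<in> H" for i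
    using quadratic_form_diff_le_fidelity[OF povm_inner_bounds[OF P _ that] norm(1)[OF that] norm(2)]
      close[OF that] by simp
  then have "(\<Sum>i\<in>H. \<psi> i \<bullet> (P i *v \<psi> i)) \<le> (\<Sum>i\<in>H. \<phi> \<bullet> (P i *v \<phi>) + \<epsilon>)"
    by (rule sum_mono)
  also have "\<dots> = 1 + real (card H) * \<epsilon>"
    using norm(2) by (simp add: sum.distrib povm_inner_sum[OF P] norm_eq_1)
  finally have "(\<Sum>i\<in>H. \<psi> i \<bullet> (P i *v \<psi> i)) / real (card H) \<le> (1 + real (card H) * \<epsilon>) / real (card H)"
    using card by (intro divide_right_mono) auto
  then show ?thesis
    using card \<open>H \<noteq> {}\<close> unfolding guess_value_def trace_mult_ketbra Re_braket
    by (simp add: sum_divide_distrib add_divide_distrib)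
qed

theorem theorem2:
  fixes H :: "'a::finite set"
    and n k :: nat
    and \<Psi> :: "'a qstate"
    and U :: "'a qop"
    and \<epsilon> :: real
  assumes "CARD('a) = n" and "card H = k" and "k \<ge> 1"
    and "norm \<Psi> = 1"
    and "0 \<le> \<epsilon>" and "\<epsilon> \<le> 1"
    and "max_fidelity (- H) \<Psi> \<ge> sqrt (1 - \<epsilon>\<^sup>2)"
    and "best_unitary (- H) \<Psi> U"
  shows "guess_prob H (\<lambda>i. sender_op i *v (U *v \<Psi>)) \<le> 1 / real k + \<epsilon>"
proof -
  have H: "H \<noteq> {}" using assms(2,3) by auto
  then obtain h where "h \<in> H" by blast
  define \<phi> :: "'a qstate" where "\<phi> = sender_op h *v ideal_state"
  have \<phi>: "sender_op i *v ideal_state = \<phi>" for i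
    by (simp add: \<phi>_def vec_eq_iff sender_op_ideal_state_nth)
  have "U \<in> local_unitaries (- H)"
    using assms(8) by (simp add: best_unitary_def is_arg_max_def)
  then have norm: "norm (sender_op i *v (U *v \<Psi>)) = 1" for i
    by (simp add: norm_sender_op norm_local_unitary assms(4))
  \<comment> \<open>A number in [0,1] is at most its square root, so the hypothesis on F' yields 1 -
    F' \<le> \<open>\<epsilon>\<^sup>2\<close>.\<close>
  have "(1 - \<epsilon>\<^sup>2)\<^sup>2 \<le> 1 - \<epsilon>\<^sup>2"
    using assms(5,6) by (simp add: power2_eq_square mult_left_le mult_le_one)
  then have "1 - \<epsilon>\<^sup>2 \<le> sqrt (1 - \<epsilon>\<^sup>2)"
    by (rule real_le_rsqrt)
  also have "\<dots> \<le> fidelity (U *v \<Psi>) ideal_state"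
    using assms(7) best_unitary_attains[OF assms(8)] by simp
  finally have close: "sqrt (1 - fidelity (sender_op i *v (U *v \<Psi>)) \<phi>) \<le> \<epsilon>" for i
    using assms(5) unfolding \<phi>[of i, symmetric] fidelity_def braket_sender_op
    by (intro real_le_lsqrt) auto
  have "norm \<phi> = 1" by (simp add: \<phi>_def norm_sender_op norm_ideal_state)
  then have "guess_value H (\<lambda>i. sender_op i *v (U *v \<Psi>)) P \<le> 1 / real k + \<epsilon>" if "povm H P" for P
    using guess_value_le[OF that H norm _ close] assms(2) by simp
  \<comment> \<open>A bound on all members bounds a real supremum only over a nonempty set.\<close>
  moreover have "{P :: 'a \<Rightarrow> 'a qop. povm H P} \<noteq> {}"
    using best_povm_exists[OF H] by (auto simp: is_arg_max_def)
  ultimately show ?thesis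
    unfolding guess_prob_def by (intro cSUP_least) auto
qed

end
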